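(* Let $A$ be a complex Banach algebra with a right identity $u$ (that is, $au=a$ for all $a\in A$) such that $uA=\{ua : a\in A\}$ is commutative and semisimple. Let $D: A\times A\to A$ be a symmetric Jordan bi-derivation. Then $D$ is a symmetric bi-derivation.
   Context: A mapping $D:A\times A\to A$ is called symmetric bi-linear if $D(a,b)=D(b,a)$, $D(\alpha a,b)=\alpha D(a,b)$ and $D(a+b,c)=D(a,c)+D(b,c)$ for all $a,b,c\in A$ and $\alpha\in\mathbb{C}$ (no continuity is assumed). A symmetric Jordan bi-derivation of $A$ is a symmetric bi-linear mapping $D:A\times A\to A$ such that $D(a^2,b)=D(a,b)a+aD(a,b)$ for all $a,b\in A$. A symmetric bi-derivation of $A$ is a symmetric bi-linear mapping $D:A\times A\to A$ such that $D(ab,c)=D(a,c)b+aD(b,c)$ for all $a,b,c\in A$. *)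

theory Defs
  imports "HOL-Analysis.Analysis"
begin

text \<open>The libraries provide real Banach algebras only. As \<open>real_normed_algebra\<close> does not demand a
  unit, the class below is that of complex Banach algebras, unital or not, with a
  submultiplicative norm.\<close>

class complex_banach_algebra = real_normed_algebra + banach +
  fixes scaleC :: "complex \<Rightarrow> 'a \<Rightarrow> 'a"  (infixr \<open>*\<^sub>C\<close> 75)
  assumes scaleC_add_right: "c *\<^sub>C (x + y) = c *\<^sub>C x + c *\<^sub>C y"
    and scaleC_add_left: "(c + d) *\<^sub>C x = c *\<^sub>C x + d *\<^sub>C x"
    and scaleC_scaleC: "c *\<^sub>C (d *\<^sub>C x) = (c * d) *\<^sub>C x"
    and scaleC_of_real: "complex_of_real r *\<^sub>C x = r *\<^sub>R x"
    and norm_scaleC: "norm (c *\<^sub>C x) = cmod c * norm x"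
    and mult_scaleC_left: "(c *\<^sub>C x) * y = c *\<^sub>C (x * y)"
    and mult_scaleC_right: "x * (c *\<^sub>C y) = c *\<^sub>C (x * y)"

lemma vector_space_scaleC: "vector_space (scaleC :: complex \<Rightarrow> 'a::complex_banach_algebra \<Rightarrow> 'a)"
proof
  show "1 *\<^sub>C x = x" for x :: 'a
    using scaleC_of_real[of 1 x] by simp
qed (simp_all add: scaleC_add_right scaleC_add_left scaleC_scaleC)

text \<open>In the next four definitions \<open>B\<close> is meant to be a subalgebra of the ambient algebra, and all
  notions are relative to \<open>B\<close>, not to the ambient algebra. In the theorem \<open>B\<close> is \<open>uA\<close>, which is a
  subalgebra because \<open>(ua)(ub) = u(ab)\<close> for a right identity \<open>u\<close>.\<close>

definition left_ideal_in :: "'a::complex_banach_algebra set \<Rightarrow> 'a set \<Rightarrow> bool" where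
  "left_ideal_in B I \<longleftrightarrow>
     I \<subseteq> B \<and> module.subspace scaleC I \<and> (\<forall>b\<in>B. \<forall>x\<in>I. b * x \<in> I)"

definition maximal_modular_left_ideal_in :: "'a::complex_banach_algebra set \<Rightarrow> 'a set \<Rightarrow> bool" where
  "maximal_modular_left_ideal_in B I \<longleftrightarrow>
     left_ideal_in B I \<and> I \<noteq> B \<and>
     (\<exists>e\<in>B. \<forall>b\<in>B. b - b * e \<in> I) \<and>
     (\<forall>J. left_ideal_in B J \<and> I \<subseteq> J \<longrightarrow> J = I \<or> J = B)"

text \<open>If \<open>B\<close> has no maximal modular left ideal, its Jacobson radical is all of \<open>B\<close>.\<close>

definition jacobson_radical :: "'a::complex_banach_algebra set \<Rightarrow> 'a set" where
  "jacobson_radical B = B \<inter> \<Inter> {I. maximal_modular_left_ideal_in B I}"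

definition semisimple :: "'a::complex_banach_algebra set \<Rightarrow> bool" where
  "semisimple B \<longleftrightarrow> jacobson_radical B = {0}"

definition symmetric_bilinear :: "('a::complex_banach_algebra \<Rightarrow> 'a \<Rightarrow> 'a) \<Rightarrow> bool" where
  "symmetric_bilinear D \<longleftrightarrow>
     (\<forall>a b. D a b = D b a) \<and>
     (\<forall>\<alpha> a b. D (\<alpha> *\<^sub>C a) b = \<alpha> *\<^sub>C D a b) \<and>
     (\<forall>a b c. D (a + b) c = D a c + D b c)"

definition symmetric_jordan_biderivation :: "('a::complex_banach_algebra \<Rightarrow> 'a \<Rightarrow> 'a) \<Rightarrow> bool" where
  "symmetric_jordan_biderivation D \<longleftrightarrow>
     symmetric_bilinear D \<and> (\<forall>a b. D (a * a) b = D a b * a + a * D a b)"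

definition symmetric_biderivation :: "('a::complex_banach_algebra \<Rightarrow> 'a \<Rightarrow> 'a) \<Rightarrow> bool" where
  "symmetric_biderivation D \<longleftrightarrow>
     symmetric_bilinear D \<and> (\<forall>a b c. D (a * b) c = D a c * b + a * D b c)"

end

theory Submission
  imports Defs
begin

text \<open>Fixing the second argument of \<open>D\<close> gives an additive Jordan derivation \<open>d\<close>, so it suffices to
  show that \<open>d\<close> is a derivation.

  As \<open>a * x = (a * u) * x = a * (u * x)\<close>, a left multiplication sees \<open>x\<close> only through \<open>u * x\<close>.
  Hence \<open>N = {n. u * n = 0}\<close> is annihilated by every left multiplication, and
  \<open>a = u * a + (a - u * a)\<close> splits the ring as \<open>uA \<oplus> N\<close>.  Polarising the Jordan identity and
  putting one argument equal to \<open>u\<close> shows that \<open>d\<close> maps \<open>N\<close> to itself (\<open>u_mult_d_eq_0\<close>) and that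
  \<open>d x = d u * x + u * d x\<close> for \<open>x\<close> in \<open>uA\<close> (\<open>d_split\<close>).  The first fact gives the Leibniz rule
  whenever one factor is in \<open>N\<close>.

  For \<open>x, y\<close> in \<open>uA\<close> the two summands of \<open>d (x * y) = d u * (x * y) + u * d (x * y)\<close> are treated
  separately: the first is already a left multiple of \<open>x * y\<close>, and the second comes from the
  polarised identity multiplied by \<open>u\<close>, all of whose terms lie in the commutative ring \<open>uA\<close>, so that
  it is twice the Leibniz rule.  Additivity in both factors then covers all products.\<close>

text \<open>Two-torsion-freeness is what allows the polarised identity to be divided by two.\<close>

locale jordan_derivation_right_identity =
  fixes u :: "'a::ring" and d :: "'a \<Rightarrow> 'a"
  assumes two_torsion_free: "x + x = 0 \<Longrightarrow> x = (0::'a)"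
    and right_identity: "a * u = a"
    and commutative: "(u * a) * (u * b) = (u * b) * (u * a)"
    and d_add: "d (a + b) = d a + d b"
    and d_square: "d (a * a) = d a * a + a * d a"
begin

lemma mult_u_left: "a * (u * x) = a * x"
  by (metis mult.assoc right_identity)

lemma mult_annihilated: "u * n = 0 \<Longrightarrow> a * n = 0"
  by (metis mult_u_left mult_zero_right)

lemma d_polarised: "d (a * b) + d (b * a) = d a * b + a * d b + d b * a + b * d a"
proof -
  have "d ((a + b) * (a + b)) = d (a * a) + d (b * b) + (d (a * b) + d (b * a))"
    by (simp add: distrib_left distrib_right d_add add_ac)
  moreover have "d ((a + b) * (a + b)) = (d a + d b) * (a + b) + (a + b) * (d a + d b)"
    by (simp add: d_square d_add)
  ultimately show ?thesis
    by (simp add: d_square algebra_simps)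
qed

lemma u_mult_d_u: "u * d u = 0"
  using d_square[of u] by (simp add: right_identity)

text \<open>Polarisation at \<open>(n, u)\<close> reads \<open>d n = d n + u * d n\<close>: the other terms are left multiples of
  \<open>n\<close> or of \<open>d u\<close>, both of which left multiplications annihilate.\<close>

lemma u_mult_d_eq_0:
  assumes "u * n = 0"
  shows "u * d n = 0"
proof -
  have "d 0 = 0"
    using d_add[of 0 0] by simp
  with d_polarised[of n u] show ?thesis
    by (simp add: assms right_identity mult_annihilated[OF assms] mult_annihilated[OF u_mult_d_u])
qed

lemma leibniz_annihilated_left:
  assumes "u * n = 0"
  shows "d (n * a) = d n * a + n * d a"
proof -
  have "d 0 = 0"
    using d_add[of 0 0] by simp
  with d_polarised[of n a] show ?thesis
    by (simp add: mult_annihilated[OF assms] mult_annihilated[OF u_mult_d_eq_0[OF assms]])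
qed

lemma leibniz_annihilated_right:
  assumes "u * n = 0"
  shows "d (a * n) = d a * n + a * d n"
proof -
  have "d 0 = 0"
    using d_add[of 0 0] by simp
  then show ?thesis
    by (simp add: mult_annihilated[OF assms] mult_annihilated[OF u_mult_d_eq_0[OF assms]])
qed

text \<open>This is polarisation at \<open>(x, u)\<close>.  It says that the component of \<open>d x\<close> in \<open>N\<close> is \<open>d u * x\<close>,
  so that on \<open>uA\<close> only the component of \<open>d\<close> in \<open>uA\<close> remains to be understood.\<close>

lemma d_split:
  assumes "u * x = x"
  shows "d x = d u * x + u * d x"
  using d_polarised[of x u]
  by (simp add: assms right_identity mult_annihilated[OF u_mult_d_u] add.assoc)

lemma u_mult_leibniz:
  assumes x: "u * x = x" and y: "u * y = y"
  shows "u * d (x * y) = u * d x * y + x * d y"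
proof -
  have xy: "x * y = y * x"
    using commutative[of x y] by (simp add: x y)
  have swap: "u * d a * b = b * d a" if "u * b = b" for a b
    using commutative[of "d a" b] by (simp add: that mult_u_left)
  have "u * d (x * y) + u * d (x * y) = u * (d (x * y) + d (y * x))"
    by (simp only: xy distrib_left)
  also have "\<dots> = u * d x * y + x * d y + u * d y * x + y * d x"
    unfolding d_polarised by (simp add: distrib_left x y flip: mult.assoc)
  also have "\<dots> = (u * d x * y + x * d y) + (u * d x * y + x * d y)"
    by (simp add: swap x y add_ac)
  finally have "(u * d (x * y) - (u * d x * y + x * d y)) +
                (u * d (x * y) - (u * d x * y + x * d y)) = 0"
    by (simp add: algebra_simps)
  from two_torsion_free[OF this] show ?thesis
    by simp
qed

lemma leibniz_on_left_fixed:
  assumes x: "u * x = x" and y: "u * y = y"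
  shows "d (x * y) = d x * y + x * d y"
proof -
  have "u * (x * y) = x * y"
    by (simp add: x flip: mult.assoc)
  then have "d (x * y) = d u * (x * y) + u * d (x * y)"
    by (rule d_split)
  also have "\<dots> = (d u * x + u * d x) * y + x * d y"
    by (simp add: u_mult_leibniz[OF x y] distrib_right mult.assoc add.assoc)
  also have "d u * x + u * d x = d x"
    by (rule d_split[OF x, symmetric])
  finally show ?thesis .
qed

theorem leibniz: "d (a * b) = d a * b + a * d b"
proof -
  define x n y m where "x = u * a" and "n = a - u * a" and "y = u * b" and "m = b - u * b"
  have a: "a = x + n" and b: "b = y + m"
    by (simp_all add: x_def n_def y_def m_def)
  have fixed: "u * x = x" "u * y = y" and annihilated: "u * n = 0" "u * m = 0"
    by (simp_all add: x_def y_def n_def m_def mult_u_left right_diff_distrib)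
  have "d (a * y) = d a * y + a * d y"
    by (simp add: a distrib_right d_add leibniz_on_left_fixed[OF fixed]
        leibniz_annihilated_left[OF annihilated(1)] add_ac)
  with leibniz_annihilated_right[OF annihilated(2), of a] show ?thesis
    by (simp add: b distrib_left d_add add_ac)
qed

end

theorem theorem2p4:
  fixes u :: "'a::complex_banach_algebra" and D :: "'a \<Rightarrow> 'a \<Rightarrow> 'a"
  assumes right_identity: "\<forall>a. a * u = a"
    and commutative: "\<forall>x \<in> {u * a | a. True}. \<forall>y \<in> {u * a | a. True}. x * y = y * x"
    and semisimple: "semisimple {u * a | a. True}"
    and jordan: "symmetric_jordan_biderivation D"
  shows "symmetric_biderivation D"
proof -
  have "D (a * b) c = D a c * b + a * D b c" for a b c
  proof -
    interpret jordan_derivation_right_identity u "\<lambda>a. D a c"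
    proof
      show "x = 0" if "x + x = 0" for x :: 'a
        using that by (simp flip: scaleR_2)
      show "(u * a) * (u * b) = (u * b) * (u * a)" for a b
        using commutative by blast
    qed (use right_identity jordan in
        \<open>auto simp: symmetric_jordan_biderivation_def symmetric_bilinear_def\<close>)
    show ?thesis
      by (rule leibniz)
  qed
  then show ?thesis
    using jordan by (simp add: symmetric_jordan_biderivation_def symmetric_biderivation_def)
qed

end
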